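(* Let $X$ be a Banach space and let $p \in \mathcal{M}_d$. Then $(PAP_d(\mathbb{Z},X,p), \Vert \cdot \Vert_{\infty})$ is a Banach space.
   Context: $\ell^{\infty}(\mathbb{Z},X)$ denotes the Banach space of all bounded two-sided sequences $u = (u_n)_{n \in \mathbb{Z}}$ with values in $X$, with norm $\Vert u \Vert_{\infty} = \sup_{n \in \mathbb{Z}} \Vert u_n \Vert$. $\mathcal{M}_d$ denotes the set of all two-sided real sequences $p = (p_n)_{n \in \mathbb{Z}}$ satisfying $p_n \geq 0$ for all $n \in \mathbb{Z}$ and $\sum_{n \in \mathbb{Z}} p_n = +\infty$. A sequence $u = (u_n)_{n \in \mathbb{Z}} \in X^{\mathbb{Z}}$ is almost periodic if for all $\varepsilon > 0$ there exists an integer $N \geq 1$ such that for all $m \in \mathbb{Z}$ there exists $q \in \{m, m+1, \dots, m+N\}$ with $\sup_{n \in \mathbb{Z}} \Vert u_{n+q} - u_n \Vert < \varepsilon$. $AP_d(\mathbb{Z},X)$ denotes the space of all such sequences (which are bounded). For $p \in \mathcal{M}_d$, a sequence $u \in \ell^{\infty}(\mathbb{Z},X)$ is weighted ergodic if $\lim_{N \to +\infty} \frac{1}{\sum_{n=-N}^{N} p_n} \sum_{n=-N}^{N} \Vert u_n \Vert p_n = 0$. $\mathcal{E}_d(\mathbb{Z},X,p)$ denotes the space of all such sequences. A sequence $u \in \ell^{\infty}(\mathbb{Z},X)$ is weighted pseudo almost periodic if $u = v+w$ with $v \in AP_d(\mathbb{Z},X)$ and $w \in \mathcal{E}_d(\mathbb{Z},X,p)$.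 $PAP_d(\mathbb{Z},X,p)$ denotes the space of all such sequences (the sum is not direct in general). *)

theory Defs
  imports "HOL-Analysis.Analysis"
begin

text \<open>
  The type \<^typ>\<open>int\<close> carries the discrete topology, so every bounded two-sided sequence is
  a bounded continuous function on it.  The Banach space of bounded two-sided sequences with the
  supremum norm is therefore the library type of bounded continuous functions on \<^typ>\<open>int\<close>;
  the next two lemmas confirm its elements and its norm.
\<close>

type_synonym 'a linf = "int \<Rightarrow>\<^sub>C 'a"

lemma range_apply_linf:
  "range (apply_bcontfun :: 'a::metric_space linf \<Rightarrow> int \<Rightarrow> 'a) = {u. bounded (range u)}"
proof -
  have "range (apply_bcontfun :: 'a linf \<Rightarrow> int \<Rightarrow> 'a) = bcontfun"
    by (rule type_definition.Rep_range[OF type_definition_bcontfun])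
  also have "\<dots> = {u. bounded (range u)}"
    by (auto simp: bcontfun_def)
  finally show ?thesis .
qed

lemma norm_linf:
  fixes u :: "'a::real_normed_vector linf"
  shows "norm u = (SUP n. norm (u n))"
  by (simp add: norm_bcontfun_def dist_bcontfun.rep_eq)

text \<open>For non-negative \<open>p\<close> the sum is taken in the extended non-negative reals.\<close>

definition M_d :: "(int \<Rightarrow> real) set" where
  "M_d = {p. (\<forall>n. p n \<ge> 0) \<and> (\<Sum>\<^sub>\<infinity>n\<in>UNIV. ennreal (p n)) = \<infinity>}"

text \<open>
  Boundedness is not part of the definition of almost periodicity, hence arbitrary sequences and
  a supremum in the extended reals (the real-valued one is unspecified on unbounded sets).
\<close>

definition AP_d :: "(int \<Rightarrow> 'a::real_normed_vector) set" where
  "AP_d = {u. \<forall>\<epsilon>::real. \<epsilon> > 0 \<longrightarrow>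
     (\<exists>N::int. N \<ge> 1 \<and> (\<forall>m::int. \<exists>q\<in>{m..m + N}.
        (SUP n. ereal (norm (u (n + q) - u n))) < ereal \<epsilon>))}"

definition E_d :: "(int \<Rightarrow> real) \<Rightarrow> 'a::real_normed_vector linf set" where
  "E_d p = {u :: 'a linf. (\<lambda>N::nat. 1 / (\<Sum>n=-int N..int N. p n) * (\<Sum>n=-int N..int N. norm (u n) * p n))
     \<longlonglongrightarrow> 0}"

definition PAP_d :: "(int \<Rightarrow> real) \<Rightarrow> 'a::real_normed_vector linf set" where
  "PAP_d p = {u :: 'a linf. \<exists>v\<in>AP_d. \<exists>w\<in>E_d p. \<forall>n. u n = v n + w n}"

end

theory Submission
  imports Defs
begin

text \<open>
  A sum of two closed subspaces need not be closed, but it is as soon as every \<open>x\<close> in the sum can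
  be split as \<open>x = a + b\<close> with \<open>\<parallel>a\<parallel> \<le> K \<parallel>x\<parallel>\<close>.  Here \<open>K = 1\<close> works: if \<open>u = v + w\<close> with \<open>v\<close> almost
  periodic and \<open>w\<close> ergodic, retract \<open>v\<close> radially onto the ball of radius \<open>c = \<parallel>u\<parallel>\<close>.  The retraction
  is Lipschitz, so the result \<open>v'\<close> is almost periodic, and
  \<open>\<parallel>v n - v' n\<parallel> = max 0 (\<parallel>v n\<parallel> - c) \<le> \<parallel>w n\<parallel>\<close>, so \<open>v - v'\<close> is ergodic and \<open>u = v' + (w + (v - v'))\<close>.
\<close>

text \<open>
  The library has this for metric domains only, and \<^typ>\<open>int\<close> is not an instance of that class.
\<close>

instance bcontfun :: (topological_space, complete_space) complete_space
proof
  fix f :: "nat \<Rightarrow> 'a \<Rightarrow>\<^sub>C 'b"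
  assume "Cauchy f"
  have "uniformly_Cauchy_on UNIV (\<lambda>n. apply_bcontfun (f n))"
  proof (rule uniformly_Cauchy_onI)
    fix e :: real assume "e > 0"
    with \<open>Cauchy f\<close> obtain M where "\<forall>m\<ge>M. \<forall>n\<ge>M. dist (f m) (f n) < e"
      unfolding Cauchy_def by blast
    then show "\<exists>M. \<forall>x\<in>UNIV. \<forall>m\<ge>M. \<forall>n\<ge>M. dist (f m x) (f n x) < e"
      by (blast intro: dist_fun_lt_imp_dist_val_lt)
  qed
  then obtain g where "uniform_limit UNIV (\<lambda>n. apply_bcontfun (f n)) g sequentially"
    using Cauchy_uniformly_convergent uniformly_convergent_on_def by blast
  then obtain l where "f \<longlonglongrightarrow> l"
    using uniform_limit_bcontfunE sequentially_bot by blast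
  then show "convergent f"
    by (rule convergentI)
qed

instance bcontfun :: (topological_space, banach) banach ..

section \<open>Closed sums of closed subspaces\<close>

text \<open>Write a point of the closure as the limit of a rapidly converging sequence
  \<open>s\<close> in the sum and split each increment of \<open>s\<close>. The norm bound makes the
  \<open>A\<close>-parts an absolutely convergent series, so the \<open>B\<close>-parts converge as
  well, and closedness puts both limits in the right subspace.\<close>

lemma closed_sums_if_bounded_decomposition:
  fixes A B :: "'a::banach set"
  assumes A: "subspace A" "closed A" and B: "subspace B" "closed B"
    and dec: "\<And>x. x \<in> {a + b |a b. a \<in> A \<and> b \<in> B} \<Longrightarrow> \<exists>a\<in>A. x - a \<in> B \<and> norm a \<le> K * norm x"
  shows "closed {a + b |a b. a \<in> A \<and> b \<in> B}" (is "closed ?S")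
proof -
  have S: "subspace ?S"
    using A(1) B(1) by (rule subspace_sums)
  have "x \<in> ?S" if x: "x \<in> closure ?S" for x
  proof -
    have "\<forall>k::nat. \<exists>y. y \<in> ?S \<and> dist y x < (1/2) ^ k"
      using x unfolding closure_approachable Bex_def by simp
    from choice[OF this] obtain s where s: "\<And>k. s k \<in> ?S" "\<And>k. dist (s k) x < (1/2) ^ k"
      by blast
    have diff: "s (Suc k) - s k \<in> ?S" for k
      using S s(1) by (intro subspace_diff)
    have "\<forall>k. \<exists>a. a \<in> A \<and> s (Suc k) - s k - a \<in> B \<and> norm a \<le> K * norm (s (Suc k) - s k)"
      using dec[OF diff] by blast
    from choice[OF this] obtain a where a: "\<And>k. a k \<in> A" "\<And>k. s (Suc k) - s k - a k \<in> B"
      "\<And>k. norm (a k) \<le> K * norm (s (Suc k) - s k)"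
      by blast
    \<comment> \<open>Both \<open>s k\<close> and \<open>s (Suc k)\<close> lie within
      \<open>(1/2) ^ k\<close> of \<open>x\<close>, hence the factor 2. The absolute value is there
      because the sign of \<open>K\<close> is arbitrary.\<close>
    have "norm (a k) \<le> \<bar>K\<bar> * 2 * (1/2) ^ k" for k
    proof -
      have "norm (s (Suc k) - s k) \<le> dist (s (Suc k)) x + dist (s k) x"
        by (metis dist_norm dist_triangle2)
      also have "\<dots> \<le> 2 * (1/2) ^ k"
        using s(2)[of k] s(2)[of "Suc k"] zero_le_dist[of "s (Suc k)" x] unfolding power_Suc by linarith
      finally have "\<bar>K\<bar> * norm (s (Suc k) - s k) \<le> \<bar>K\<bar> * (2 * (1/2) ^ k)"
        by (intro mult_left_mono) auto
      moreover have "K * norm (s (Suc k) - s k) \<le> \<bar>K\<bar> * norm (s (Suc k) - s k)"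
        by (intro mult_right_mono) auto
      ultimately show ?thesis
        using a(3)[of k] by simp
    qed
    moreover have "summable (\<lambda>k. \<bar>K\<bar> * 2 * (1/2) ^ k :: real)"
      by (intro summable_mult summable_geometric) simp
    ultimately have "summable a"
      by (metis summable_comparison_test')
    then have lim: "(\<lambda>n. \<Sum>k<n. a k) \<longlonglongrightarrow> suminf a"
      by (rule summable_LIMSEQ)
    have "suminf a \<in> A"
      using A(2) _ lim by (rule closed_sequentially) (use A(1) a(1) in \<open>auto intro: subspace_sum\<close>)
    have "s \<longlonglongrightarrow> x"
    proof (rule metric_tendsto_imp_tendsto)
      show "(\<lambda>k. (1/2) ^ k :: real) \<longlonglongrightarrow> 0"
        by (rule LIMSEQ_power_zero) simp
      show "\<forall>\<^sub>F k in sequentially. dist (s k) x \<le> dist ((1/2) ^ k :: real) 0"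
        using s(2) by (auto intro!: always_eventually less_imp_le)
    qed
    then have lim': "(\<lambda>n. s n - s 0 - (\<Sum>k<n. a k)) \<longlonglongrightarrow> x - s 0 - suminf a"
      by (intro tendsto_intros lim)
    \<comment> \<open>By telescoping, this is the sum of the \<open>B\<close>-parts of the first
      \<open>n\<close> increments.\<close>
    have "s n - s 0 - (\<Sum>k<n. a k) \<in> B" for n
    proof -
      have "s n - s 0 - (\<Sum>k<n. a k) = (\<Sum>k<n. s (Suc k) - s k - a k)"
        using sum_lessThan_telescope[of s n] by (simp add: sum_subtractf)
      then show ?thesis
        using B(1) a(2) by (simp add: subspace_sum)
    qed
    with B(2) have "x - s 0 - suminf a \<in> B"
      using lim' by (rule closed_sequentially)
    with \<open>suminf a \<in> A\<close> have "suminf a + (x - s 0 - suminf a) \<in> ?S"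
      by blast
    from subspace_add[OF S s(1)[of 0] this] show ?thesis
      by simp
  qed
  then show ?thesis
    using closure_subset_eq by blast
qed

section \<open>Relatively dense sets of integers\<close>

definition relatively_dense :: "int set \<Rightarrow> bool" where
  "relatively_dense S \<longleftrightarrow> (\<exists>N. \<forall>m. \<exists>q\<in>{m..m + N}. q \<in> S)"

lemma relatively_dense_mono: "relatively_dense S \<Longrightarrow> S \<subseteq> T \<Longrightarrow> relatively_dense T"
  unfolding relatively_dense_def by blast

text \<open>
  In every window pick one element of \<open>S\<close> and one of \<open>T\<close>.  Their difference takes finitely many
  values, so a translate of the window by a bounded amount contains a suitable element.
\<close>

lemma relatively_dense_common_differences:
  assumes "relatively_dense S" "relatively_dense T"
  shows "relatively_dense {q. (\<exists>a\<in>S. \<exists>a'\<in>S. q = a - a') \<and> (\<exists>b\<in>T. \<exists>b'\<in>T. q = b - b')}"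
proof -
  have window: "\<exists>L f. \<forall>m. f m \<in> R \<and> m \<le> f m \<and> f m \<le> m + L" if "relatively_dense R" for R
  proof -
    obtain L where "\<And>m. \<exists>q. q \<in> R \<and> m \<le> q \<and> q \<le> m + L"
      using \<open>relatively_dense R\<close> unfolding relatively_dense_def Bex_def atLeastAtMost_iff by blast
    then have "\<exists>f. \<forall>m. f m \<in> R \<and> m \<le> f m \<and> f m \<le> m + L"
      by (intro choice) simp
    then show ?thesis ..
  qed
  obtain L f where f: "\<And>m. f m \<in> S" "\<And>m. m \<le> f m" "\<And>m. f m \<le> m + L"
    using window[OF assms(1)] by blast
  obtain M g where g: "\<And>m. g m \<in> T" "\<And>m. m \<le> g m" "\<And>m. g m \<le> m + M"
    using window[OF assms(2)] by blast
  define D where "D = range (\<lambda>m. f m - g m)"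
  have "D \<subseteq> {- M..L}"
  proof
    fix d assume "d \<in> D"
    then obtain m where "d = f m - g m"
      unfolding D_def by blast
    with f(2,3)[of m] g(2,3)[of m] show "d \<in> {- M..L}"
      by simp
  qed
  then have "finite D"
    by (rule finite_subset) simp
  have "\<forall>d\<in>D. \<exists>k. d = f k - g k"
    unfolding D_def by blast
  \<comment> \<open>\<open>r d\<close> is a reference index for the difference \<open>d\<close>. If
    \<open>k\<close> has the same difference, then \<open>f k - f (r d)\<close> equals
    \<open>g k - g (r d)\<close>, so one number is a difference in both \<open>S\<close> and
    \<open>T\<close>.\<close>
  then obtain r where r: "\<And>d. d \<in> D \<Longrightarrow> d = f (r d) - g (r d)"
    using bchoice[of D "\<lambda>d k. d = f k - g k"] by blast
  define C where "C = Max (insert 0 ((\<lambda>d. \<bar>f (r d)\<bar>) ` D))"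
  have C: "\<bar>f (r d)\<bar> \<le> C" if "d \<in> D" for d
    unfolding C_def using that \<open>finite D\<close> by (intro Max_ge) auto
  show ?thesis
    unfolding relatively_dense_def
  \<comment> \<open>Subtracting \<open>f (r d)\<close> moves a point by at most \<open>C\<close>
    either way. Starting the window at \<open>m + C\<close> keeps \<open>q\<close> at or above
    \<open>m\<close>, and its upper end becomes \<open>m + L + 2 * C\<close>.\<close>
  proof (intro exI[of _ "L + 2 * C"] allI)
    fix m
    define k where "k = m + C"
    define d where "d = f k - g k"
    have "d \<in> D"
      unfolding d_def D_def by blast
    define q where "q = f k - f (r d)"
    have "q = g k - g (r d)"
      using r[OF \<open>d \<in> D\<close>] unfolding q_def d_def by linarith
    moreover have "q \<in> {m..m + (L + 2 * C)}"
      using f(2,3)[of k] C[OF \<open>d \<in> D\<close>] unfolding q_def k_def by auto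
    ultimately show "\<exists>q\<in>{m..m + (L + 2 * C)}.
        q \<in> {q. (\<exists>a\<in>S. \<exists>a'\<in>S. q = a - a') \<and> (\<exists>b\<in>T. \<exists>b'\<in>T. q = b - b')}"
      using f(1) g(1) q_def by blast
  qed
qed

section \<open>Almost periodic sequences\<close>

text \<open>These are Bohr's translation numbers, with a non-strict pointwise bound in place of a
  strict bound on a supremum.\<close>

definition periods :: "(int \<Rightarrow> 'a::real_normed_vector) \<Rightarrow> real \<Rightarrow> int set" where
  "periods u e = {q. \<forall>n. norm (u (n + q) - u n) \<le> e}"

text \<open>For a fixed tolerance the strict and the non-strict bound differ, but not when all
  tolerances are considered: the way back uses \<open>e/2\<close>.\<close>

lemma AP_d_iff: "u \<in> AP_d \<longleftrightarrow> (\<forall>e>0. relatively_dense (periods u e))"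
proof
  assume u: "u \<in> AP_d"
  show "\<forall>e>0. relatively_dense (periods u e)"
  proof (intro allI impI)
    fix e :: real assume "e > 0"
    with u obtain N where N: "\<And>m. \<exists>q\<in>{m..m + N}.
        (SUP n. ereal (norm (u (n + q) - u n))) < ereal e"
      unfolding AP_d_def by blast
    have "q \<in> periods u e" if "(SUP n. ereal (norm (u (n + q) - u n))) < ereal e" for q
    proof -
      have "ereal (norm (u (n + q) - u n)) \<le> ereal e" for n
        using SUP_upper[of n UNIV "\<lambda>n. ereal (norm (u (n + q) - u n))"] that
        by (metis UNIV_I le_less_trans less_imp_le)
      then show ?thesis
        unfolding periods_def by simp
    qed
    with N show "relatively_dense (periods u e)"
      unfolding relatively_dense_def by metis
  qed
next
  assume u: "\<forall>e>0. relatively_dense (periods u e)"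
  show "u \<in> AP_d"
    unfolding AP_d_def
  proof (intro CollectI allI impI)
    fix e :: real assume e: "e > 0"
    then obtain N where N: "\<And>m. \<exists>q\<in>{m..m + N}. q \<in> periods u (e/2)"
      using u unfolding relatively_dense_def by (meson half_gt_zero)
    have sup: "(SUP n. ereal (norm (u (n + q) - u n))) < ereal e" if "q \<in> periods u (e/2)" for q
    proof -
      have "(SUP n. ereal (norm (u (n + q) - u n))) \<le> ereal (e/2)"
        using that by (intro SUP_least) (simp add: periods_def)
      also have "\<dots> < ereal e"
        using e by simp
      finally show ?thesis .
    qed
    \<comment> \<open>\<open>relatively_dense\<close> gives no lower bound on \<open>N\<close>,
      whereas \<open>AP_d\<close> asks for at least 1. A longer window still contains the same
      \<open>q\<close>.\<close>
    have "\<exists>q\<in>{m..m + max 1 N}. (SUP n. ereal (norm (u (n + q) - u n))) < ereal e" for m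
    proof -
      obtain q where "q \<in> {m..m + N}" "q \<in> periods u (e/2)"
        using N by blast
      with sup show ?thesis
        by (intro bexI[of _ q]) auto
    qed
    then show "\<exists>N\<ge>1. \<forall>m. \<exists>q\<in>{m..m + N}. (SUP n. ereal (norm (u (n + q) - u n))) < ereal e"
      by (intro exI[of _ "max 1 N"]) simp
  qed
qed

text \<open>A modulus of continuity of \<open>f\<close> turns translation numbers of
  \<open>u\<close> into translation numbers of the composition. This serves both scalar multiples
  and the radial retraction.\<close>

lemma AP_d_uniformly_continuous:
  fixes f :: "'a::real_normed_vector \<Rightarrow> 'b::real_normed_vector"
  assumes f: "uniformly_continuous_on UNIV f" and u: "u \<in> AP_d"
  shows "(\<lambda>n. f (u n)) \<in> AP_d"
  unfolding AP_d_iff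
proof (intro allI impI)
  fix e :: real assume "e > 0"
  then obtain d where d: "d > 0" "\<And>x y. dist x y < d \<Longrightarrow> dist (f x) (f y) < e"
    using f unfolding uniformly_continuous_on_def by (metis UNIV_I)
  have "periods u (d/2) \<subseteq> periods (\<lambda>n. f (u n)) e"
  proof
    fix q assume "q \<in> periods u (d/2)"
    then have "dist (u (n + q)) (u n) < d" for n
      using d(1) unfolding periods_def dist_norm by (smt (verit) field_sum_of_halves mem_Collect_eq)
    with d(2) show "q \<in> periods (\<lambda>n. f (u n)) e"
      unfolding periods_def dist_norm by (simp add: less_imp_le)
  qed
  moreover have "relatively_dense (periods u (d/2))"
    using u d(1) by (simp add: AP_d_iff)
  ultimately show "relatively_dense (periods (\<lambda>n. f (u n)) e)"
    by (rule relatively_dense_mono[rotated])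
qed

text \<open>Compare from the base point \<open>n - b\<close>: shifting it by \<open>a\<close> or by
  \<open>b\<close> changes \<open>u\<close> by at most \<open>e\<close>, and the shift by
  \<open>b\<close> lands on \<open>n\<close>.\<close>

lemma periods_diff:
  assumes "a \<in> periods u e" "b \<in> periods u e"
  shows "a - b \<in> periods u (2 * e)"
  unfolding periods_def
proof (intro CollectI allI)
  fix n
  have "norm (u ((n - b) + a) - u (n - b)) \<le> e" "norm (u ((n - b) + b) - u (n - b)) \<le> e"
    using assms unfolding periods_def by blast+
  then have "norm ((u ((n - b) + a) - u (n - b)) - (u ((n - b) + b) - u (n - b))) \<le> e + e"
    by (intro norm_triangle_le_diff) simp
  then show "norm (u (n + (a - b)) - u n) \<le> 2 * e"
    by (simp add: algebra_simps)
qed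

text \<open>Translation numbers of \<open>u\<close> and of \<open>v\<close> need not coincide, but
  their difference sets have a relatively dense intersection. Passing to differences doubles the
  tolerance and adding the sequences doubles it again, hence \<open>e/4\<close>.\<close>

lemma AP_d_add:
  assumes "u \<in> AP_d" "v \<in> AP_d"
  shows "(\<lambda>n. u n + v n) \<in> AP_d"
  unfolding AP_d_iff
proof (intro allI impI)
  fix e :: real assume "e > 0"
  let ?S = "periods u (e/4)" and ?T = "periods v (e/4)"
  have "relatively_dense ?S" "relatively_dense ?T"
    using assms \<open>e > 0\<close> by (simp_all add: AP_d_iff)
  then have "relatively_dense {q. (\<exists>a\<in>?S. \<exists>a'\<in>?S. q = a - a') \<and> (\<exists>b\<in>?T. \<exists>b'\<in>?T. q = b - b')}"
    by (rule relatively_dense_common_differences)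
  then show "relatively_dense (periods (\<lambda>n. u n + v n) e)"
  proof (rule relatively_dense_mono, safe)
    fix a a' b b' assume "a \<in> ?S" "a' \<in> ?S" "b \<in> ?T" "b' \<in> ?T" "a - a' = b - b'"
    then have "a - a' \<in> periods u (e/2)" "a - a' \<in> periods v (e/2)"
      using periods_diff[of a u "e/4" a'] periods_diff[of b v "e/4" b'] by simp_all
    then have *: "norm (u (n + (a - a')) - u n) \<le> e/2" "norm (v (n + (a - a')) - v n) \<le> e/2" for n
      unfolding periods_def by blast+
    show "a - a' \<in> periods (\<lambda>n. u n + v n) e"
      unfolding periods_def add_diff_add
      using norm_add_rule_thm[OF *] by simp
  qed
qed

lemma subspace_AP_d: "subspace {v :: 'a::real_normed_vector linf. apply_bcontfun v \<in> AP_d}"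
proof (rule subspaceI)
  have "relatively_dense (periods (\<lambda>n. 0 :: 'a) e)" if "e > 0" for e
    using that unfolding relatively_dense_def periods_def by (intro exI[of _ 0]) auto
  then show "0 \<in> {v :: 'a linf. apply_bcontfun v \<in> AP_d}"
    by (simp add: AP_d_iff zero_bcontfun.rep_eq)
next
  fix x y :: "'a linf"
  assume "x \<in> {v. apply_bcontfun v \<in> AP_d}" "y \<in> {v. apply_bcontfun v \<in> AP_d}"
  then show "x + y \<in> {v. apply_bcontfun v \<in> AP_d}"
    by (simp add: plus_bcontfun.rep_eq AP_d_add)
next
  fix c :: real and x :: "'a linf"
  assume "x \<in> {v. apply_bcontfun v \<in> AP_d}"
  then show "c *\<^sub>R x \<in> {v. apply_bcontfun v \<in> AP_d}"
    using AP_d_uniformly_continuous[OF bounded_linear.uniformly_continuous_on[OF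
          bounded_linear_scaleR_right uniformly_continuous_on_id, of UNIV c]]
    by (simp add: scaleR_bcontfun.rep_eq)
qed

lemma closed_AP_d: "closed {v :: 'a::real_normed_vector linf. apply_bcontfun v \<in> AP_d}"
proof -
  have "apply_bcontfun x \<in> AP_d"
    if x: "x \<in> closure {v :: 'a linf. apply_bcontfun v \<in> AP_d}" for x
    unfolding AP_d_iff
  proof (intro allI impI)
    fix e :: real assume "e > 0"
    then obtain v where v: "apply_bcontfun v \<in> AP_d" "dist v x < e/3"
      using x unfolding closure_approachable by (metis mem_Collect_eq divide_pos_pos zero_less_numeral)
    have "periods v (e/3) \<subseteq> periods x e"
    proof
      fix q assume q: "q \<in> periods v (e/3)"
      have "dist (x (n + q)) (x n) \<le> e" for n
      proof -
        have "dist (v (n + q)) (x (n + q)) \<le> e/3" "dist (v n) (x n) \<le> e/3"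
          using dist_bounded[of v _ x] v(2) by (meson order_trans less_imp_le)+
        moreover have "dist (v (n + q)) (v n) \<le> e/3"
          using q unfolding periods_def dist_norm by blast
        ultimately show ?thesis
          using dist_triangle[of "x (n + q)" "x n" "v n"] dist_triangle3[of "x (n + q)" "v n" "v (n + q)"]
          by linarith
      qed
      then show "q \<in> periods x e"
        unfolding periods_def dist_norm by blast
    qed
    moreover have "relatively_dense (periods v (e/3))"
      using v(1) \<open>e > 0\<close> by (simp add: AP_d_iff)
    ultimately show "relatively_dense (periods x e)"
      by (rule relatively_dense_mono[rotated])
  qed
  then show ?thesis
    using closure_subset_eq by blast
qed

section \<open>Weighted ergodic sequences\<close>

text \<open>Real functions replace norms so that linearity and monotonicity can be stated. If the
  weights up to \<open>N\<close> sum to 0, division by zero makes the mean 0, so the rules below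
  hold for every \<open>N\<close>.\<close>

definition weighted_mean :: "(int \<Rightarrow> real) \<Rightarrow> (int \<Rightarrow> real) \<Rightarrow> nat \<Rightarrow> real" where
  "weighted_mean p f N = 1 / (\<Sum>n=-int N..int N. p n) * (\<Sum>n=-int N..int N. f n * p n)"

lemma E_d_iff: "u \<in> E_d p \<longleftrightarrow> weighted_mean p (\<lambda>n. norm (u n)) \<longlonglongrightarrow> 0"
  by (simp add: E_d_def weighted_mean_def[abs_def])

lemma weighted_mean_add:
  "weighted_mean p (\<lambda>n. f n + g n) N = weighted_mean p f N + weighted_mean p g N"
  by (simp add: weighted_mean_def distrib_right sum.distrib distrib_left add_divide_distrib)

lemma weighted_mean_cmult: "weighted_mean p (\<lambda>n. c * f n) N = c * weighted_mean p f N"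
  by (simp add: weighted_mean_def mult.assoc flip: sum_distrib_left)

context
  fixes p :: "int \<Rightarrow> real"
  assumes p: "\<And>n. p n \<ge> 0"
begin

lemma weighted_mean_mono:
  assumes "\<And>n. f n \<le> g n"
  shows "weighted_mean p f N \<le> weighted_mean p g N"
  unfolding weighted_mean_def
  using assms p by (intro mult_left_mono sum_mono mult_right_mono) (auto simp: sum_nonneg)

lemma weighted_mean_nonneg: "(\<And>n. f n \<ge> 0) \<Longrightarrow> weighted_mean p f N \<ge> 0"
  unfolding weighted_mean_def using p by (intro mult_nonneg_nonneg) (auto intro!: sum_nonneg)

text \<open>Equality fails only when the weights up to \<open>N\<close> sum to 0; then the mean is
  0, which is at most \<open>c\<close>.\<close>

lemma weighted_mean_const_le: "c \<ge> 0 \<Longrightarrow> weighted_mean p (\<lambda>_. c) N \<le> c"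
  unfolding weighted_mean_def by (simp flip: sum_distrib_left)

lemma E_d_dominated:
  fixes u :: "'a::real_normed_vector linf"
  assumes w: "weighted_mean p f \<longlonglongrightarrow> 0" and u: "\<And>n. norm (u n) \<le> f n"
  shows "u \<in> E_d p"
  unfolding E_d_iff
proof (rule tendsto_sandwich[OF _ _ tendsto_const w])
  show "\<forall>\<^sub>F N in sequentially. 0 \<le> weighted_mean p (\<lambda>n. norm (u n)) N"
    by (intro always_eventually allI weighted_mean_nonneg) simp
  show "\<forall>\<^sub>F N in sequentially. weighted_mean p (\<lambda>n. norm (u n)) N \<le> weighted_mean p f N"
    using u by (intro always_eventually allI weighted_mean_mono)
qed

lemma subspace_E_d: "subspace (E_d p :: 'a::real_normed_vector linf set)"
proof (rule subspaceI)
  show "0 \<in> (E_d p :: 'a linf set)"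
    by (simp add: E_d_iff weighted_mean_def[abs_def] zero_bcontfun.rep_eq)
next
  fix x y :: "'a linf"
  assume "x \<in> E_d p" "y \<in> E_d p"
  then have "weighted_mean p (\<lambda>n. norm (x n) + norm (y n)) \<longlonglongrightarrow> 0"
    unfolding E_d_iff weighted_mean_add by (rule tendsto_add_zero)
  then show "x + y \<in> E_d p"
    by (rule E_d_dominated) (simp add: plus_bcontfun.rep_eq norm_triangle_ineq)
next
  fix c :: real and x :: "'a linf"
  assume "x \<in> E_d p"
  then have "weighted_mean p (\<lambda>n. \<bar>c\<bar> * norm (x n)) \<longlonglongrightarrow> 0"
    unfolding E_d_iff weighted_mean_cmult by (rule tendsto_mult_right_zero)
  then show "c *\<^sub>R x \<in> E_d p"
    by (rule E_d_dominated) (simp add: scaleR_bcontfun.rep_eq)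
qed

text \<open>A uniform error of \<open>e/2\<close> changes the mean by at most \<open>e/2\<close>,
  for all \<open>N\<close> at once.\<close>

lemma closed_E_d: "closed (E_d p :: 'a::real_normed_vector linf set)"
proof -
  have "x \<in> E_d p" if x: "x \<in> closure (E_d p)" for x :: "'a linf"
    unfolding E_d_iff
  proof (rule tendstoI)
    fix e :: real assume "e > 0"
    then obtain w where w: "w \<in> E_d p" "dist w x < e/2"
      using x unfolding closure_approachable by (meson half_gt_zero)
    have "\<forall>\<^sub>F N in sequentially. dist (weighted_mean p (\<lambda>n. norm (w n)) N) 0 < e/2"
      using w(1) \<open>e > 0\<close> unfolding E_d_iff by (intro tendstoD) auto
    then show "\<forall>\<^sub>F N in sequentially. dist (weighted_mean p (\<lambda>n. norm (x n)) N) 0 < e"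
    proof (eventually_elim)
      case (elim N)
      have "norm (x n) \<le> norm (w n) + e/2" for n
        using dist_bounded[of w n x] w(2) norm_triangle_sub[of "x n" "w n"]
        by (simp add: dist_norm norm_minus_commute)
      then have "weighted_mean p (\<lambda>n. norm (x n)) N \<le> weighted_mean p (\<lambda>n. norm (w n) + e/2) N"
        by (rule weighted_mean_mono)
      also have "\<dots> \<le> weighted_mean p (\<lambda>n. norm (w n)) N + e/2"
        using weighted_mean_const_le[of "e/2" N] \<open>e > 0\<close> by (simp add: weighted_mean_add)
      finally show ?case
        using elim weighted_mean_nonneg[of "\<lambda>n. norm (x n)" N] by (simp add: dist_real_def)
    qed
  qed
  then show ?thesis
    using closure_subset_eq by blast
qed

end

section \<open>Radial retraction onto a ball\<close>

text \<open>For \<open>c = 0\<close> the convention \<open>0 / 0 = 0\<close> makes this the zero map, as it should be.\<close>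

definition ball_retract :: "real \<Rightarrow> 'a::real_normed_vector \<Rightarrow> 'a" where
  "ball_retract c x = (c / max c (norm x)) *\<^sub>R x"

lemma norm_ball_retract_le: "c \<ge> 0 \<Longrightarrow> norm (ball_retract c x) \<le> c"
  by (auto simp: ball_retract_def max_def field_simps intro: mult_left_mono)

lemma norm_diff_ball_retract:
  assumes "c \<ge> 0"
  shows "norm (x - ball_retract c x) = max 0 (norm x - c)"
proof (cases "norm x \<le> c")
  case True
  then show ?thesis
    \<comment> \<open>If \<open>c = 0\<close>, the quotient is \<open>0 / 0 = 0\<close> instead of
      1, but then \<open>x = 0\<close>.\<close>
    by (cases "c = 0") (auto simp: ball_retract_def max_def)
next
  case False
  then have "norm x > 0"
    using assms by linarith
  have *: "x - ball_retract c x = (1 - c / norm x) *\<^sub>R x"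
    using False by (simp add: ball_retract_def max_def scaleR_left_diff_distrib)
  show ?thesis
    using False assms \<open>norm x > 0\<close> by (simp only: * norm_scaleR) (simp add: max_def abs_if field_simps)
qed

text \<open>Split the difference into a scaled \<open>x - y\<close> and a change of the scalar
  acting on \<open>y\<close>. As \<open>max c\<close> of the norm is 1-Lipschitz and the factors
  \<open>c / a\<close> and \<open>norm y / b\<close> are at most 1, each part contributes at most
  \<open>norm (x - y)\<close>.\<close>

lemma ball_retract_lipschitz:
  fixes x y :: "'a::real_normed_vector"
  assumes "c \<ge> 0"
  shows "norm (ball_retract c x - ball_retract c y) \<le> 2 * norm (x - y)"
proof (cases "c = 0")
  case True
  then show ?thesis
    by (simp add: ball_retract_def)
next
  case False
  define a b where "a = max c (norm x)" and "b = max c (norm y)"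
  have ab: "a > 0" "b > 0" "c \<le> a" "norm y \<le> b" and c: "c > 0"
    using False assms by (auto simp: a_def b_def)
  have "\<bar>b - a\<bar> \<le> \<bar>norm y - norm x\<bar>"
    unfolding a_def b_def by linarith
  also have "\<dots> \<le> norm (x - y)"
    by (metis norm_minus_commute norm_triangle_ineq3)
  finally have ba: "\<bar>b - a\<bar> \<le> norm (x - y)" .
  have "c / a - c / b = (c / a) * ((b - a) / b)"
    using ab by (simp add: field_simps)
  then have "ball_retract c x - ball_retract c y = (c / a) *\<^sub>R (x - y) + ((c / a) * ((b - a) / b)) *\<^sub>R y"
    by (simp add: ball_retract_def flip: a_def b_def) (simp add: algebra_simps flip: scaleR_left_diff_distrib)
  also have "norm \<dots> \<le> (c / a) * norm (x - y) + (c / a) * (\<bar>b - a\<bar> * (norm y / b))"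
    using ab c by (intro norm_triangle_le) (simp add: abs_mult)
  also have "\<dots> \<le> 1 * norm (x - y) + 1 * (norm (x - y) * 1)"
    using ab c ba by (intro add_mono mult_mono) auto
  finally show ?thesis
    by simp
qed

lemma uniformly_continuous_ball_retract:
  "c \<ge> 0 \<Longrightarrow> uniformly_continuous_on UNIV (ball_retract c :: 'a::real_normed_vector \<Rightarrow> 'a)"
  by (rule lipschitz_on_uniformly_continuous[of 2])
    (auto intro!: lipschitz_onI simp: dist_norm ball_retract_lipschitz)

section \<open>Norm-controlled splitting and completeness\<close>

lemma bounded_decomposition:
  fixes v w :: "'a::real_normed_vector linf"
  assumes p: "\<And>n. p n \<ge> 0" and v: "apply_bcontfun v \<in> AP_d" and w: "w \<in> E_d p"
  obtains v' :: "'a linf"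
  where "apply_bcontfun v' \<in> AP_d" "v + w - v' \<in> E_d p" "norm v' \<le> norm (v + w)"
proof -
  define c where "c = norm (v + w)"
  have c: "c \<ge> 0"
    by (simp add: c_def)
  define v' :: "'a linf" where "v' = Bcontfun (\<lambda>n. ball_retract c (v n))"
  have "(\<lambda>n. ball_retract c (v n)) \<in> bcontfun"
    unfolding bcontfun_def bounded_iff using norm_ball_retract_le[OF c] by auto
  then have v': "apply_bcontfun v' = (\<lambda>n. ball_retract c (v n))"
    by (simp add: v'_def Bcontfun_inverse)
  have "v - v' \<in> E_d p"
  proof (rule E_d_dominated[of p, OF p])
    show "weighted_mean p (\<lambda>n. norm (w n)) \<longlonglongrightarrow> 0"
      using w by (simp add: E_d_iff)
    show "norm ((v - v') n) \<le> norm (w n)" for n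
    proof -
      \<comment> \<open>The reverse triangle inequality then gives
        \<open>norm (v n) - c \<le> norm (w n)\<close>, which bounds the distance from
        \<open>v n\<close> to the ball.\<close>
      have "norm (v n + w n) \<le> c"
        using norm_bounded[of "v + w" n] by (simp add: c_def plus_bcontfun.rep_eq)
      then show ?thesis
        using norm_diff_ineq[of "v n" "w n"]
        by (simp add: minus_bcontfun.rep_eq v' norm_diff_ball_retract[OF c])
    qed
  qed
  then have "v + w - v' \<in> E_d p"
    using subspace_add[OF subspace_E_d[of p, OF p] w, of "v - v'"] by (simp add: algebra_simps)
  moreover have "apply_bcontfun v' \<in> AP_d"
    unfolding v' using uniformly_continuous_ball_retract[OF c] v by (rule AP_d_uniformly_continuous)
  moreover have "norm v' \<le> norm (v + w)"
    by (rule norm_bound) (simp add: v' norm_ball_retract_le[OF c] flip: c_def)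
  ultimately show thesis
    by (intro that)
qed

text \<open>In \<open>PAP_d\<close> the almost periodic part is a bare function. It equals
  \<open>u - w\<close>, so it inherits boundedness from \<open>u\<close> and \<open>w\<close> and is
  an element of the Banach space.\<close>

lemma PAP_d_eq_sums:
  "PAP_d p = {v + w |v w. v \<in> {v :: 'a::real_normed_vector linf. apply_bcontfun v \<in> AP_d} \<and> w \<in> E_d p}"
proof (intro set_eqI iffI)
  fix u :: "'a linf" assume "u \<in> PAP_d p"
  then obtain v w where v: "v \<in> AP_d" and w: "w \<in> E_d p" and u: "\<And>n. u n = v n + w n"
    unfolding PAP_d_def by blast
  have "apply_bcontfun (u - w) = v"
    by (auto simp: minus_bcontfun.rep_eq u)
  with v w show "u \<in> {v + w |v w. v \<in> {v. apply_bcontfun v \<in> AP_d} \<and> w \<in> E_d p}"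
    by (intro CollectI exI[of _ "u - w"] exI[of _ w]) simp
next
  fix u :: "'a linf" assume "u \<in> {v + w |v w. v \<in> {v. apply_bcontfun v \<in> AP_d} \<and> w \<in> E_d p}"
  then obtain v w where "apply_bcontfun v \<in> AP_d" "w \<in> E_d p" "u = v + w"
    by blast
  then show "u \<in> PAP_d p"
    unfolding PAP_d_def by (intro CollectI bexI[of _ "apply_bcontfun v"] bexI[of _ w]) (simp_all add: plus_bcontfun.rep_eq)
qed

theorem theorem8p6:
  fixes p :: "int \<Rightarrow> real"
  assumes "p \<in> M_d"
  shows "subspace (PAP_d p :: 'a::banach linf set) \<and> complete (PAP_d p :: 'a linf set)"
proof -
  have p: "p n \<ge> 0" for n
    using assms by (simp add: M_d_def)
  show ?thesis
    \<comment> \<open>The ambient space is complete, so completeness of the subspace amounts to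
      closedness.\<close>
    unfolding PAP_d_eq_sums complete_eq_closed
  proof
    show "closed {v + w |v w. v \<in> {v :: 'a linf. apply_bcontfun v \<in> AP_d} \<and> w \<in> E_d p}"
    proof (rule closed_sums_if_bounded_decomposition[where K = 1])
      fix x :: "'a linf"
      assume "x \<in> {v + w |v w. v \<in> {v. apply_bcontfun v \<in> AP_d} \<and> w \<in> E_d p}"
      then obtain v w where "apply_bcontfun v \<in> AP_d" "w \<in> E_d p" "x = v + w"
        by blast
      then show "\<exists>a\<in>{v. apply_bcontfun v \<in> AP_d}. x - a \<in> E_d p \<and> norm a \<le> 1 * norm x"
        using bounded_decomposition[of p v w] p by auto
    qed (use p in \<open>simp_all add: subspace_AP_d closed_AP_d subspace_E_d closed_E_d\<close>)
  qed (rule subspace_sums[OF subspace_AP_d subspace_E_d[of p, OF p]])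
qed

end
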